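(* Let $\mathscr{A}$ be a complex Banach algebra with unity $1$, and let $a,b\in\mathscr{A}$ be p-Drazin invertible with $ab=ba$. Then $a+b$ is p-Drazin invertible if and only if $1+a^{\ddagger}b$ is p-Drazin invertible. In this case, $$(a+b)^{\ddagger}=(1+a^{\ddagger}b)^{\ddagger}a^{\ddagger}+b^{\ddagger}\sum_{i=0}^{\infty}(-b^{\ddagger}aa^{\Pi})^{i}a^{\Pi},$$ and $$(1+a^{\ddagger}b)^{\ddagger}=a^{\Pi}+a^{2}a^{\ddagger}(a+b)^{\ddagger}.$$
   Context: $J(\mathscr{A})$ denotes the Jacobson radical of $\mathscr{A}$. An element $a\in\mathscr{A}$ is called pseudo Drazin invertible (p-Drazin invertible) if there exists $x\in\mathscr{A}$ such that $ax=xa$, $xax=x$, and $a^{k}-a^{k+1}x\in J(\mathscr{A})$ for some integer $k\geqslant 1$. Such an $x$ is unique when it exists; it is called the p-Drazin inverse of $a$ and is denoted by $a^{\ddagger}$. For a p-Drazin invertible element $a$, $a^{\Pi}=1-aa^{\ddagger}$. The zeroth power of any element is $1$, and infinite series converge in the norm of $\mathscr{A}$. *)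

theory Defs
  imports "HOL-Analysis.Analysis"
begin

section \<open>Complex unital Banach algebras\<close>

class scaleC = scaleR +
  fixes scaleC :: "complex \<Rightarrow> 'a \<Rightarrow> 'a"  (infixr \<open>*\<^sub>C\<close> 75)

text \<open>
  Neither \<open>norm 1 = 1\<close> nor \<open>0 \<noteq> 1\<close> is demanded: the unit need not be normalised, so the class
  extends \<^class>\<open>real_normed_algebra\<close> and \<^class>\<open>ring_1\<close> rather than \<^class>\<open>real_normed_algebra_1\<close>.
\<close>

class complex_banach_algebra_1 = scaleC + real_normed_algebra + ring_1 + banach +
  assumes scaleR_scaleC: "r *\<^sub>R x = complex_of_real r *\<^sub>C x"
    and scaleC_add_right: "c *\<^sub>C (x + y) = c *\<^sub>C x + c *\<^sub>C y"
    and scaleC_add_left: "(c + d) *\<^sub>C x = c *\<^sub>C x + d *\<^sub>C x"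
    and scaleC_scaleC: "c *\<^sub>C d *\<^sub>C x = (c * d) *\<^sub>C x"
    and scaleC_one: "1 *\<^sub>C x = x"
    and mult_scaleC_left: "(c *\<^sub>C x) * y = c *\<^sub>C (x * y)"
    and mult_scaleC_right: "x * (c *\<^sub>C y) = c *\<^sub>C (x * y)"
    and norm_scaleC: "norm (c *\<^sub>C x) = cmod c * norm x"

instantiation complex :: complex_banach_algebra_1
begin

definition scaleC_complex :: "complex \<Rightarrow> complex \<Rightarrow> complex"
  where "scaleC_complex c x = c * x"

instance
  by standard (simp_all add: scaleC_complex_def scaleR_conv_of_real norm_mult algebra_simps)

end


section \<open>The Jacobson radical of a (noncommutative) unital ring\<close>

text \<open>Closure under negation follows from closure under left multiplication by \<open>- 1\<close>.\<close>

definition left_ideal :: "'a::ring_1 set \<Rightarrow> bool"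
  where "left_ideal I \<longleftrightarrow>
    0 \<in> I \<and> (\<forall>x\<in>I. \<forall>y\<in>I. x + y \<in> I) \<and> (\<forall>r. \<forall>x\<in>I. r * x \<in> I)"

definition maximal_left_ideal :: "'a::ring_1 set \<Rightarrow> bool"
  where "maximal_left_ideal M \<longleftrightarrow>
    left_ideal M \<and> M \<noteq> UNIV \<and> (\<forall>I. left_ideal I \<and> M \<subseteq> I \<longrightarrow> I = M \<or> I = UNIV)"

definition jacobson_radical :: "'a::ring_1 set"
  where "jacobson_radical = \<Inter> {M. maximal_left_ideal M}"


section \<open>Pseudo Drazin inverses\<close>

definition is_pdrazin_inverse :: "'a::ring_1 \<Rightarrow> 'a \<Rightarrow> bool"
  where "is_pdrazin_inverse a x \<longleftrightarrow>
    a * x = x * a \<and> x * a * x = x \<and> (\<exists>k\<ge>1. a ^ k - a ^ (k + 1) * x \<in> jacobson_radical)"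

definition pdrazin_invertible :: "'a::ring_1 \<Rightarrow> bool"
  where "pdrazin_invertible a \<longleftrightarrow> (\<exists>x. is_pdrazin_inverse a x)"

definition pdrazin_inverse :: "'a::ring_1 \<Rightarrow> 'a"  (\<open>(_\<^sup>\<ddagger>)\<close> [1000] 999)
  where "a\<^sup>\<ddagger> = (THE x. is_pdrazin_inverse a x)"

definition pdrazin_idempotent :: "'a::ring_1 \<Rightarrow> 'a"  (\<open>(_\<^sup>\<Pi>)\<close> [1000] 999)
  where "a\<^sup>\<Pi> = 1 - a * a\<^sup>\<ddagger>"

end

theory Submission
  imports Defs
begin

text \<open>
  An element of the Jacobson radical is quasinilpotent, so \<open>a * a\<^sup>\<Pi>\<close>, some power of which lies in the
  radical, is quasinilpotent too. Hence \<open>a\<^sup>\<ddagger>\<close> commutes with everything that commutes with \<open>a\<close>: for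
  \<open>c\<close> commuting with \<open>a\<close>, the corner \<open>d = (1 - a\<^sup>\<Pi>) * c * a\<^sup>\<Pi>\<close> satisfies
  \<open>d = (a\<^sup>\<ddagger>) ^ n * d * (a * a\<^sup>\<Pi>) ^ n\<close> for all \<open>n\<close> and so vanishes, and likewise for the
  opposite corner. Therefore all elements in the theorem commute, and the idempotent \<open>a\<^sup>\<Pi>\<close> splits
  the problem. On the \<open>a * a\<^sup>\<ddagger>\<close> part, \<open>a\<close> is invertible and \<open>a + b = a * (1 + a\<^sup>\<ddagger> * b)\<close>. On the
  \<open>a\<^sup>\<Pi>\<close> part, \<open>1 + a\<^sup>\<ddagger> * b\<close> is the unit, while \<open>a + b\<close> is the invertible element \<open>b * (1 + b\<^sup>\<ddagger> * a)\<close> on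
  \<open>b * b\<^sup>\<ddagger>\<close>, inverted by a Neumann series, and nilpotent modulo the radical on \<open>b\<^sup>\<Pi>\<close>.
\<close>

section \<open>The Jacobson radical\<close>

lemma left_idealD:
  assumes "left_ideal I"
  shows left_ideal_zero: "0 \<in> I"
    and left_ideal_add: "x \<in> I \<Longrightarrow> y \<in> I \<Longrightarrow> x + y \<in> I"
    and left_ideal_mult: "x \<in> I \<Longrightarrow> r * x \<in> I"
  using assms by (simp_all add: left_ideal_def)

lemma left_ideal_jacobson_radical: "left_ideal jacobson_radical"
  unfolding left_ideal_def[of jacobson_radical]
  by (auto simp: jacobson_radical_def maximal_left_ideal_def
      intro: left_ideal_zero left_ideal_add left_ideal_mult)

lemmas jacobson_radical_add = left_ideal_add[OF left_ideal_jacobson_radical]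
  and jacobson_radical_mult_left = left_ideal_mult[OF left_ideal_jacobson_radical]

lemma left_ideal_eq_UNIV_iff:
  assumes "left_ideal I"
  shows "I = UNIV \<longleftrightarrow> 1 \<in> I"
proof
  assume "1 \<in> I"
  then have "r * 1 \<in> I" for r
    using assms by (rule left_ideal_mult[rotated])
  then show "I = UNIV"
    by auto
qed simp

lemma left_ideal_Union_chain:
  assumes "C \<noteq> {}" and "\<And>I. I \<in> C \<Longrightarrow> left_ideal I"
    and chain: "\<And>I K. I \<in> C \<Longrightarrow> K \<in> C \<Longrightarrow> I \<subseteq> K \<or> K \<subseteq> I"
  shows "left_ideal (\<Union>C)"
  unfolding left_ideal_def
proof (intro conjI ballI allI)
  show "0 \<in> \<Union>C"
    using assms(1,2) left_ideal_zero by auto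
  show "r * x \<in> \<Union>C" if "x \<in> \<Union>C" for r x
    using that by (blast intro: left_ideal_mult assms(2))
  fix x y
  assume "x \<in> \<Union>C" "y \<in> \<Union>C"
  then obtain I K where I: "I \<in> C" "x \<in> I" and K: "K \<in> C" "y \<in> K"
    by auto
  from chain[OF I(1) K(1)] show "x + y \<in> \<Union>C"
  proof
    assume "I \<subseteq> K"
    then show ?thesis
      using I K left_ideal_add[OF assms(2)[OF K(1)], of x y] by (intro UnionI[of K]) auto
  next
    assume "K \<subseteq> I"
    then show ?thesis
      using I K left_ideal_add[OF assms(2)[OF I(1)], of x y] by (intro UnionI[of I]) auto
  qed
qed

text \<open>Zorn's lemma on the left ideals that contain \<open>I\<close> and omit \<open>1\<close>:
  omitting \<open>1\<close> passes to unions of chains. A left ideal containing \<open>1\<close> is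
  everything, so a maximal member of this family is a maximal left ideal.\<close>

lemma proper_left_ideal_subset_maximal:
  assumes "left_ideal I" and "1 \<notin> I"
  obtains M where "maximal_left_ideal M" and "I \<subseteq> M"
proof -
  let ?A = "{K. left_ideal K \<and> I \<subseteq> K \<and> 1 \<notin> K}"
  have "\<exists>M\<in>?A. \<forall>X\<in>?A. M \<subseteq> X \<longrightarrow> X = M"
  proof (rule subset_Zorn_nonempty)
    show "?A \<noteq> {}"
      using assms by blast
    fix C
    assume C: "C \<noteq> {}" "subset.chain ?A C"
    then have A: "K \<in> ?A" if "K \<in> C" for K
      using that unfolding subset_chain_def by auto
    have "left_ideal (\<Union>C)"
      using C A unfolding subset_chain_def by (intro left_ideal_Union_chain) auto
    moreover have "I \<subseteq> \<Union>C" "1 \<notin> \<Union>C"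
      using A \<open>C \<noteq> {}\<close> by auto
    ultimately show "\<Union>C \<in> ?A"
      by simp
  qed
  then obtain M where M: "M \<in> ?A" and max: "\<forall>X\<in>?A. M \<subseteq> X \<longrightarrow> X = M"
    by (rule bexE)
  have "maximal_left_ideal M"
    unfolding maximal_left_ideal_def
  proof (intro conjI allI impI)
    show "left_ideal M" "M \<noteq> UNIV"
      using M by auto
    fix K
    assume K: "left_ideal K \<and> M \<subseteq> K"
    show "K = M \<or> K = UNIV"
    proof (cases "1 \<in> K")
      case True
      then show ?thesis
        using K left_ideal_eq_UNIV_iff[of K] by simp
    next
      case False
      then have "K \<in> ?A"
        using K M by auto
      then show ?thesis
        using K max by simp
    qed
  qed
  moreover have "I \<subseteq> M"
    using M by simp
  ultimately show ?thesis
    by (rule that)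
qed

text \<open>If the left ideal generated by \<open>1 - j\<close> were proper, some maximal left ideal
  would contain both \<open>1 - j\<close> and \<open>j\<close>, hence \<open>1\<close>.\<close>

lemma jacobson_radical_left_invertible:
  fixes j :: "'a::ring_1"
  assumes "j \<in> jacobson_radical"
  obtains u where "u * (1 - j) = 1"
proof -
  let ?I = "range (\<lambda>r. r * (1 - j))"
  have I: "left_ideal ?I"
    unfolding left_ideal_def
  proof (intro conjI ballI allI)
    show "0 \<in> ?I"
      by (metis mult_zero_left rangeI)
    show "x + y \<in> ?I" if "x \<in> ?I" "y \<in> ?I" for x y
      using that by (auto simp: distrib_right[symmetric])
    show "r * x \<in> ?I" if "x \<in> ?I" for r x
      using that by (auto simp: mult.assoc[symmetric])
  qed
  have "1 \<in> ?I"
  proof (rule ccontr)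
    assume "1 \<notin> ?I"
    then obtain M where M: "maximal_left_ideal M" "?I \<subseteq> M"
      using I proper_left_ideal_subset_maximal by blast
    have "1 - j \<in> M"
      using M(2) by (metis mult_1 rangeI subsetD)
    moreover have "j \<in> M"
      using assms M(1) unfolding jacobson_radical_def by blast
    ultimately have "1 \<in> M"
      using M(1) unfolding maximal_left_ideal_def left_ideal_def by (metis diff_add_cancel)
    then show False
      using M(1) left_ideal_eq_UNIV_iff unfolding maximal_left_ideal_def by blast
  qed
  then obtain u where "1 = u * (1 - j)"
    by (rule rangeE)
  then show ?thesis
    using that[OF sym] by blast
qed

lemma jacobson_radical_invertible:
  fixes j :: "'a::ring_1"
  assumes "j \<in> jacobson_radical"
  obtains u where "u * (1 - j) = 1" and "(1 - j) * u = 1"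
proof -
  obtain u where u: "u * (1 - j) = 1"
    by (rule jacobson_radical_left_invertible[OF assms])
  \<comment> \<open>\<open>u = 1 + u * j\<close> is itself left invertible, and its left inverse must be \<open>1 - j\<close>.\<close>
  obtain v where v: "v * (1 - (- u * j)) = 1"
    by (rule jacobson_radical_left_invertible[OF jacobson_radical_mult_left[OF assms]])
  have "1 - (- u * j) = u"
    using u by (simp add: algebra_simps)
  then have "v * u = 1"
    using v by simp
  then have "v = 1 - j"
    using u by (metis mult.assoc mult_1 mult.right_neutral)
  then show ?thesis
    using that[of u] u \<open>v * u = 1\<close> by simp
qed

section \<open>Quasinilpotent elements\<close>

lemma scaleC_zero_left: "0 *\<^sub>C x = 0" for x :: "'a::complex_banach_algebra_1"
  using scaleR_scaleC[of 0 x] by simp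

lemma scaleC_sum_left: "(\<Sum>i\<in>I. c i) *\<^sub>C x = (\<Sum>i\<in>I. c i *\<^sub>C x)"
  for x :: "'a::complex_banach_algebra_1"
  by (induction I rule: infinite_finite_induct) (simp_all add: scaleC_zero_left scaleC_add_left)

lemma scaleC_power: "(c *\<^sub>C x) ^ n = c ^ n *\<^sub>C x ^ n"
  for x :: "'a::complex_banach_algebra_1"
  by (induction n)
    (simp_all add: scaleC_one mult_scaleC_left mult_scaleC_right scaleC_scaleC mult.commute)

lemma scaleC_diff_left: "(c - d) *\<^sub>C x = c *\<^sub>C x - d *\<^sub>C x"
  for x :: "'a::complex_banach_algebra_1"
  using scaleC_add_left[of "c - d" d x] by (simp add: algebra_simps)

text \<open>A root-free form of spectral radius zero, that is, of the \<open>n\<close>-th root of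
  \<open>norm (x ^ n)\<close> tending to 0.\<close>

definition quasinilpotent :: "'a::{real_normed_algebra,ring_1} \<Rightarrow> bool"
  where "quasinilpotent x \<longleftrightarrow> (\<forall>r\<ge>0. (\<lambda>n. r ^ n * norm (x ^ n)) \<longlonglongrightarrow> 0)"

text \<open>The factor \<open>norm 1\<close> accounts for \<open>n = 0\<close>, as the unit need not
  have norm one.\<close>

lemma norm_power_le: "norm (x ^ n) \<le> norm (1::'a) * norm x ^ n"
  for x :: "'a::{real_normed_algebra,ring_1}"
proof (induction n)
  case (Suc n)
  have "norm (x ^ Suc n) \<le> norm x * norm (x ^ n)"
    by (simp add: norm_mult_ineq)
  also have "\<dots> \<le> norm x * (norm (1::'a) * norm x ^ n)"
    using Suc by (simp add: mult_left_mono)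
  finally show ?case
    by (simp add: algebra_simps)
qed simp

lemma quasinilpotent_eq_0I:
  fixes d v :: "'a::{real_normed_algebra,ring_1}"
  assumes "quasinilpotent v" and "0 \<le> r" and le: "\<And>n. norm d \<le> K * (r ^ n * norm (v ^ n))"
  shows "d = 0"
proof -
  have "(\<lambda>n. K * (r ^ n * norm (v ^ n))) \<longlonglongrightarrow> K * 0"
    using assms(1,2) unfolding quasinilpotent_def by (intro tendsto_mult_left) blast
  then have "norm d \<le> K * 0"
    by (rule LIMSEQ_le_const) (use le in blast)
  then show ?thesis
    by simp
qed

text \<open>The choice \<open>r = 2\<close> in the definition gives eventual domination by a
  geometric series of ratio \<open>1/2\<close>.\<close>

lemma quasinilpotent_summable:
  fixes x p :: "'a::{real_normed_algebra,ring_1,banach}"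
  assumes "quasinilpotent x"
  shows "summable (\<lambda>n. x ^ n * p)"
proof -
  have "(\<lambda>n. 2 ^ n * norm (x ^ n)) \<longlonglongrightarrow> 0"
    using assms unfolding quasinilpotent_def by simp
  then have "\<forall>\<^sub>F n in sequentially. 2 ^ n * norm (x ^ n) < 1"
    by (rule order_tendstoD) simp
  then have ev: "\<forall>\<^sub>F n in sequentially. norm (x ^ n * p) \<le> norm p * (1/2) ^ n"
  proof eventually_elim
    case (elim n)
    have "norm (x ^ n * p) \<le> norm (x ^ n) * norm p"
      by (rule norm_mult_ineq)
    also have "\<dots> \<le> (1/2) ^ n * norm p"
      using elim by (intro mult_right_mono) (simp_all add: field_simps)
    finally show ?case
      by (simp add: mult.commute)
  qed
  have "summable (\<lambda>n. norm p * (1/2::real) ^ n)"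
    by (intro summable_mult summable_geometric) simp
  then show ?thesis
    by (rule summable_comparison_test_ev[OF ev])
qed

section \<open>Averages of the resolvent over roots of unity\<close>

lemma sum_roots_of_unity_powers:
  fixes n m :: nat
  defines "\<omega> \<equiv> exp (2 * of_real pi * \<i> * of_nat 1 / of_nat n)"
  assumes "m < n"
  shows "(\<Sum>k<n. (\<omega> ^ k) ^ m) = (if m = 0 then of_nat n else 0)"
proof (cases "m = 0")
  case False
  have pow: "\<omega> ^ j = exp (2 * of_real pi * \<i> * of_nat j / of_nat n)" for j
    unfolding \<omega>_def by (simp flip: exp_of_nat_mult add: algebra_simps)
  \<comment> \<open>\<open>1\<close> is written as the root of unity of index 0, so that
    distinctness reduces to \<open>m\<close> and \<open>0\<close> being incongruent modulo
    \<open>n\<close>.\<close>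
  have "\<omega> ^ m \<noteq> exp (2 * of_real pi * \<i> * of_nat 0 / of_nat n)"
    unfolding pow using assms False by (subst complex_root_unity_eq) (auto simp: cong_def)
  then have ne: "\<omega> ^ m \<noteq> 1"
    by simp
  have "\<omega> ^ n = 1"
    using \<open>m < n\<close> pow[of n] by (simp add: exp_two_pi_i)
  then have one: "(\<omega> ^ m) ^ n = 1"
    by (metis mult.commute power_mult power_one)
  have "(\<Sum>k<n. (\<omega> ^ k) ^ m) = (\<Sum>k<n. (\<omega> ^ m) ^ k)"
    by (simp flip: power_mult add: mult.commute)
  also have "\<dots> = 0"
    using ne one by (simp add: geometric_sum)
  finally show ?thesis
    using False by simp
qed simp

lemma left_inverse_geometric:
  fixes y :: "'a::ring_1"
  assumes "r * (1 - y) = 1"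
  shows "r * (1 - y ^ n) = (\<Sum>m<n. y ^ m)"
proof (induction n)
  case (Suc n)
  have "r * (1 - y ^ Suc n) = r * (1 - y ^ n) + r * (1 - y) * y ^ n"
    by (simp add: algebra_simps)
  then show ?case
    using Suc assms by simp
qed simp

text \<open>As \<open>\<omega> ^ n = 1\<close>, all the elements
  \<open>(\<omega> ^ k * c) *\<^sub>C x\<close> have the same \<open>n\<close>-th power, so each
  resolvent turns the right factor into a geometric sum in \<open>x\<close>. Summing over
  \<open>k\<close>, orthogonality of the roots of unity leaves only the term
  \<open>m = 0\<close>.\<close>

lemma sum_resolvent_roots_of_unity:
  fixes x :: "'a::complex_banach_algebra_1"
  assumes R: "\<And>c. R c * (1 - c *\<^sub>C x) = 1" and "0 < n"
  defines "\<omega> \<equiv> exp (2 * of_real pi * \<i> * of_nat 1 / of_nat n)"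
  shows "(inverse (real n) *\<^sub>R (\<Sum>k<n. R (\<omega> ^ k * c))) * (1 - c ^ n *\<^sub>C x ^ n) = 1"
proof -
  have "\<omega> ^ n = 1"
    unfolding \<omega>_def using \<open>0 < n\<close> by (simp flip: exp_of_nat_mult add: exp_two_pi_i)
  then have \<omega>n: "(\<omega> ^ k) ^ n = 1" for k
    by (metis mult.commute power_mult power_one)
  have "R (\<omega> ^ k * c) * (1 - c ^ n *\<^sub>C x ^ n) = (\<Sum>m<n. ((\<omega> ^ k) ^ m * c ^ m) *\<^sub>C x ^ m)" for k
    using left_inverse_geometric[OF R[of "\<omega> ^ k * c"], of n]
    by (simp add: scaleC_power power_mult_distrib \<omega>n)
  then have "(\<Sum>k<n. R (\<omega> ^ k * c)) * (1 - c ^ n *\<^sub>C x ^ n)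
      = (\<Sum>k<n. \<Sum>m<n. ((\<omega> ^ k) ^ m * c ^ m) *\<^sub>C x ^ m)"
    by (simp add: sum_distrib_right)
  also have "\<dots> = (\<Sum>m<n. ((\<Sum>k<n. (\<omega> ^ k) ^ m) * c ^ m) *\<^sub>C x ^ m)"
    by (subst sum.swap) (simp add: sum_distrib_right scaleC_sum_left)
  also have "\<dots> = (\<Sum>m<n. if m = 0 then of_nat n *\<^sub>C 1 else 0)"
    by (intro sum.cong refl)
      (auto simp: \<omega>_def sum_roots_of_unity_powers[simplified] scaleC_zero_left)
  also have "\<dots> = of_nat n *\<^sub>C 1"
    using \<open>0 < n\<close> by (simp add: sum.delta)
  also have "\<dots> = real n *\<^sub>R 1"
    by (simp add: scaleR_scaleC)
  finally show ?thesis
    using \<open>0 < n\<close> by simp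
qed

text \<open>The resolvent identity \<open>R d - R c = (d - c) *\<^sub>C (R d * x * R c)\<close>
  gives continuity once \<open>norm (R d)\<close> is bounded near \<open>c\<close>, and the identity
  itself supplies that bound.\<close>

lemma continuous_resolvent:
  fixes x :: "'a::complex_banach_algebra_1"
  assumes R: "\<And>c. R c * (1 - c *\<^sub>C x) = 1" and R': "\<And>c. (1 - c *\<^sub>C x) * R c = 1"
  shows "isCont R c"
proof -
  have eq: "R d - R c = (d - c) *\<^sub>C (R d * x * R c)" for d
  proof -
    have "R d - R c = R d * ((1 - c *\<^sub>C x) * R c) - (R d * (1 - d *\<^sub>C x)) * R c"
      by (simp add: R R')
    also have "\<dots> = R d * (d *\<^sub>C x - c *\<^sub>C x) * R c"
      by (simp add: algebra_simps)
    finally show ?thesis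
      by (simp add: scaleC_diff_left[symmetric] mult_scaleC_left mult_scaleC_right)
  qed
  define K where "K = norm x * norm (R c)"
  have le: "norm (R d - R c) \<le> cmod (d - c) * (norm (R d) * K)" for d
  proof -
    have "norm (R d * x * R c) \<le> norm (R d) * K"
      unfolding K_def mult.assoc
      by (intro order_trans[OF norm_mult_ineq] mult_left_mono norm_mult_ineq) simp
    then show ?thesis
      by (simp add: eq norm_scaleC mult_left_mono)
  qed
  have lim: "((\<lambda>d. cmod (d - c) * K) \<longlongrightarrow> 0) (at c)"
    by (rule tendsto_eq_intros refl | simp)+
  then have "\<forall>\<^sub>F d in at c. cmod (d - c) * K < 1/2"
    by (rule order_tendstoD) simp
  then have "\<forall>\<^sub>F d in at c. norm (R d - R c) \<le> cmod (d - c) * K * (2 * norm (R c))"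
  proof eventually_elim
    case (elim d)
    \<comment> \<open>Near \<open>c\<close> the right side is at most half of
      \<open>norm (R d)\<close> and can be absorbed on the left.\<close>
    have "norm (R d) - norm (R c) \<le> (cmod (d - c) * K) * norm (R d)"
      using le[of d] norm_triangle_ineq2[of "R d" "R c"] by (simp add: algebra_simps)
    also have "\<dots> \<le> 1/2 * norm (R d)"
      using elim by (intro mult_right_mono) auto
    finally have "norm (R d) \<le> 2 * norm (R c)"
      by simp
    then have "cmod (d - c) * K * norm (R d) \<le> cmod (d - c) * K * (2 * norm (R c))"
      by (intro mult_left_mono) (auto simp: K_def)
    then show ?case
      using le[of d] by (simp add: algebra_simps)
  qed
  moreover have "((\<lambda>d. cmod (d - c) * K * (2 * norm (R c))) \<longlongrightarrow> 0) (at c)"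
    using tendsto_mult_left_zero[OF lim] .
  ultimately have "((\<lambda>d. R d - R c) \<longlongrightarrow> 0) (at c)"
    by (rule Lim_null_comparison)
  then show ?thesis
    by (simp add: isCont_def LIM_zero_iff)
qed

text \<open>Expanding the product gives \<open>y = s * y - s\<close>, where \<open>norm s\<close> is
  below one. This lemma and its mirror below carry smallness between \<open>1 - S n c\<close> and
  \<open>c ^ n *\<^sub>R x ^ n\<close> in the radius argument.\<close>

lemma norm_quasi_inverse_le:
  fixes s y :: "'a::{real_normed_algebra,ring_1}"
  assumes "(1 - s) * (1 - y) = 1" and "norm s \<le> r" and "r < 1"
  shows "norm y \<le> r / (1 - r)"
proof -
  have "y = s * y - s"
    using assms(1) by (simp add: algebra_simps)
  then have "norm y \<le> norm (s * y) + norm s"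
    by (metis norm_triangle_ineq4)
  also have "\<dots> \<le> r * norm y + r"
    using assms(2) norm_mult_ineq[of s y] mult_right_mono[OF assms(2), of "norm y"] by simp
  finally show ?thesis
    using \<open>r < 1\<close> by (simp add: field_simps)
qed

lemma norm_quasi_inverse_le':
  fixes s y :: "'a::{real_normed_algebra,ring_1}"
  assumes "(1 - s) * (1 - y) = 1" and "norm y \<le> r" and "r < 1"
  shows "norm s \<le> r / (1 - r)"
proof -
  have "s = s * y - y"
    using assms(1) by (simp add: algebra_simps)
  then have "norm s \<le> norm (s * y) + norm y"
    by (metis norm_triangle_ineq4)
  also have "\<dots> \<le> norm s * r + r"
    using assms(2) norm_mult_ineq[of s y] mult_left_mono[OF assms(2), of "norm s"] by simp
  finally show ?thesis
    using \<open>r < 1\<close> by (simp add: field_simps)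
qed

section \<open>From an everywhere defined resolvent to quasinilpotence\<close>

lemma null_sequence_mono:
  fixes s t :: real and f :: "nat \<Rightarrow> real"
  assumes "(\<lambda>n. t ^ n * f n) \<longlonglongrightarrow> 0" and "0 \<le> s" and "s \<le> t" and "\<And>n. 0 \<le> f n"
  shows "(\<lambda>n. s ^ n * f n) \<longlonglongrightarrow> 0"
proof (rule Lim_null_comparison[OF _ assms(1)])
  show "\<forall>\<^sub>F n in sequentially. norm (s ^ n * f n) \<le> t ^ n * f n"
    using assms(2-4) by (auto simp: abs_mult intro!: always_eventually mult_right_mono power_mono)
qed

text \<open>
  Rickart's elementary argument: averaging the resolvent over the \<open>n\<close>-th roots of unity inverts
  \<open>1 - c ^ n *\<^sub>C x ^ n\<close>. These averages inherit the modulus of uniform continuity of the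
  resolvent, independently of \<open>n\<close>, so the region where \<open>t ^ n * norm (x ^ n)\<close> tends to \<open>0\<close> can be
  enlarged by steps of a fixed length.
\<close>

theorem quasinilpotentI:
  fixes x :: "'a::complex_banach_algebra_1"
  assumes inv: "\<And>c. \<exists>u. u * (1 - c *\<^sub>C x) = 1 \<and> (1 - c *\<^sub>C x) * u = 1"
  shows "quasinilpotent x"
  unfolding quasinilpotent_def
proof (intro allI impI)
  fix M :: real
  assume "0 \<le> M"
  obtain R where R: "\<And>c. R c * (1 - c *\<^sub>C x) = 1" and R': "\<And>c. (1 - c *\<^sub>C x) * R c = 1"
    using inv by metis
  \<comment> \<open>The radius \<open>M + 1\<close> leaves room for the points
    \<open>t + 2 * h\<close> with \<open>t \<le> M\<close>, since \<open>2 * h < 1\<close>.\<close>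
  have "continuous_on (cball 0 (M + 1)) R"
    using continuous_resolvent[OF R R'] continuous_at_imp_continuous_on by blast
  then have "uniformly_continuous_on (cball 0 (M + 1)) R"
    by (rule compact_uniformly_continuous) simp
  then obtain d where "0 < d"
    and d: "\<And>c c'. cmod c \<le> M + 1 \<Longrightarrow> cmod c' \<le> M + 1 \<Longrightarrow> dist c' c < d
      \<Longrightarrow> dist (R c') (R c) < 1/6"
    by (rule uniformly_continuous_onE[of _ _ "1/6"]) auto
  define h where "h = min (d / 4) (1 / 4)"
  have h: "0 < h" "2 * h < d" "2 * h < 1"
    using \<open>0 < d\<close> by (auto simp: h_def)
  define S where "S n c = inverse (real n) *\<^sub>R
    (\<Sum>k<n. R (exp (2 * of_real pi * \<i> * of_nat 1 / of_nat n) ^ k * of_real c))" for n c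
  have S: "S n c * (1 - c ^ n *\<^sub>R x ^ n) = 1" if "0 < n" for n c
    using sum_resolvent_roots_of_unity[OF R that, of "of_real c"]
    unfolding S_def by (simp add: scaleR_scaleC)
  \<comment> \<open>Multiplication by a root of unity is an isometry, so every summand moves by at
    most \<open>1/6\<close>, and so does the average, whatever \<open>n\<close> is.\<close>
  have S_close: "norm (S n c' - S n c) \<le> 1/6"
    if "0 < n" "\<bar>c\<bar> \<le> M + 1" "\<bar>c'\<bar> \<le> M + 1" "\<bar>c' - c\<bar> < d" for n c c'
  proof -
    define \<omega> where "\<omega> = exp (2 * of_real pi * \<i> * of_nat 1 / of_nat n)"
    have [simp]: "cmod \<omega> = 1"
      by (simp add: \<omega>_def norm_exp_eq_Re)
    have "norm (\<Sum>k<n. R (\<omega> ^ k * of_real c') - R (\<omega> ^ k * of_real c)) \<le> real (card {..<n}) * (1/6)"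
    proof (rule sum_norm_bound)
      fix k
      have "dist (\<omega> ^ k * of_real c') (\<omega> ^ k * of_real c) = \<bar>c' - c\<bar>"
        unfolding dist_norm by (simp flip: right_diff_distrib of_real_diff add: norm_mult norm_power)
      then show "norm (R (\<omega> ^ k * of_real c') - R (\<omega> ^ k * of_real c)) \<le> 1/6"
        using that unfolding dist_norm[symmetric] by (intro less_imp_le[OF d]) (simp_all add: norm_mult norm_power)
    qed
    moreover have "S n c' - S n c
        = inverse (real n) *\<^sub>R (\<Sum>k<n. R (\<omega> ^ k * of_real c') - R (\<omega> ^ k * of_real c))"
      by (simp add: S_def \<omega>_def sum_subtractf scaleR_diff_right)
    ultimately show ?thesis
      using \<open>0 < n\<close> by (simp add: field_simps)
  qed
  have step: "(\<lambda>n. (t + h) ^ n * norm (x ^ n)) \<longlonglongrightarrow> 0"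
    if lim: "(\<lambda>n. t ^ n * norm (x ^ n)) \<longlonglongrightarrow> 0" and t: "0 \<le> t" "t \<le> M" for t
  proof -
    \<comment> \<open>The bound \<open>1/4\<close> puts \<open>S n t\<close> within
      \<open>1/3\<close> of \<open>1\<close>; moving to \<open>t + 2 * h\<close> costs another
      \<open>1/6\<close>; a distance of \<open>1/2\<close> then bounds the power term by
      \<open>1\<close>.\<close>
    have "\<forall>\<^sub>F n in sequentially. t ^ n * norm (x ^ n) < 1/4"
      using lim by (rule order_tendstoD) simp
    then have "\<forall>\<^sub>F n in sequentially. (t + 2 * h) ^ n * norm (x ^ n) \<le> 1"
      using eventually_gt_at_top[of 0]
    proof eventually_elim
      case (elim n)
      have "(1 - (1 - S n t)) * (1 - t ^ n *\<^sub>R x ^ n) = 1"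
        using S[OF elim(2)] by simp
      then have "norm (1 - S n t) \<le> (1/4) / (1 - 1/4)"
        by (rule norm_quasi_inverse_le') (use elim t in auto)
      moreover have "norm (S n (t + 2 * h) - S n t) \<le> 1/6"
        using elim t h by (intro S_close) auto
      ultimately have "norm ((1 - S n t) - (S n (t + 2 * h) - S n t)) \<le> 1/2"
        by (intro order_trans[OF norm_triangle_ineq4]) simp
      then have "norm (1 - S n (t + 2 * h)) \<le> 1/2"
        by simp
      moreover have "(1 - (1 - S n (t + 2 * h))) * (1 - (t + 2 * h) ^ n *\<^sub>R x ^ n) = 1"
        using S[OF elim(2)] by simp
      ultimately have "norm ((t + 2 * h) ^ n *\<^sub>R x ^ n) \<le> (1/2) / (1 - 1/2)"
        by (intro norm_quasi_inverse_le) auto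
      then show ?case
        using t h by simp
    qed
    \<comment> \<open>Boundedness at \<open>t + 2 * h\<close> becomes geometric decay at the smaller
      \<open>t + h\<close>.\<close>
    then have "\<forall>\<^sub>F n in sequentially.
        norm ((t + h) ^ n * norm (x ^ n)) \<le> ((t + h) / (t + 2 * h)) ^ n"
    proof eventually_elim
      case (elim n)
      have "(t + h) ^ n * norm (x ^ n)
          = ((t + h) / (t + 2 * h)) ^ n * ((t + 2 * h) ^ n * norm (x ^ n))"
        using t h by (simp add: power_divide)
      also have "\<dots> \<le> ((t + h) / (t + 2 * h)) ^ n * 1"
        using elim t h by (intro mult_left_mono) auto
      finally show ?case
        using t h by simp
    qed
    moreover have "(\<lambda>n. ((t + h) / (t + 2 * h)) ^ n) \<longlonglongrightarrow> 0"
      using t h by (intro LIMSEQ_realpow_zero) auto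
    ultimately show ?thesis
      by (rule Lim_null_comparison)
  qed
  \<comment> \<open>The start is 0, whose positive powers vanish; \<open>min\<close> keeps the base
    within the range of \<open>step\<close>.\<close>
  have reach: "(\<lambda>n. min (real j * h) M ^ n * norm (x ^ n)) \<longlonglongrightarrow> 0" for j
  proof (induction j)
    case 0
    have "\<forall>\<^sub>F n in sequentially. min (real 0 * h) M ^ n * norm (x ^ n) = 0"
      using eventually_gt_at_top[of 0] by eventually_elim (use \<open>0 \<le> M\<close> in simp)
    then show ?case
      by (rule tendsto_eventually)
  next
    case (Suc j)
    show ?case
      by (rule null_sequence_mono[OF step[OF Suc]])
        (use h \<open>0 \<le> M\<close> in \<open>auto simp: min_def algebra_simps\<close>)
  qed
  obtain j where "M < real j * h"
    using h(1) ex_less_of_nat_mult by blast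
  then show "(\<lambda>n. M ^ n * norm (x ^ n)) \<longlonglongrightarrow> 0"
    using reach[of j] by (simp add: min_absorb2)
qed

section \<open>Nilpotency modulo the radical\<close>

definition radical_nilpotent :: "'a::ring_1 \<Rightarrow> bool"
  where "radical_nilpotent c \<longleftrightarrow> (\<exists>k. c ^ k \<in> jacobson_radical)"

text \<open>As a rewrite rule together with \<open>mult.assoc\<close>, it sorts products of elements
  known to commute.\<close>

lemma mult_left_commuting: "a * b = b * a \<Longrightarrow> a * (b * c) = b * (a * c)"
  for a b c :: "'a::semigroup_mult"
  by (metis mult.assoc)

lemma power_mult_commuting:
  fixes c d :: "'a::monoid_mult"
  assumes "c * d = d * c"
  shows "(c * d) ^ n = c ^ n * d ^ n"
proof (induction n)
  case (Suc n)
  have "d * c ^ n = c ^ n * d"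
    using power_commuting_commutes[of c d n] assms by simp
  then show ?case
    using Suc by (simp add: mult.assoc mult_left_commuting[of d "c ^ n"])
qed simp

lemma radical_nilpotent_mult:
  assumes "radical_nilpotent c" and "d * c = c * d"
  shows "radical_nilpotent (d * c)"
  using assms(1) power_mult_commuting[OF assms(2)] jacobson_radical_mult_left
  unfolding radical_nilpotent_def by metis

lemma jacobson_radical_power_mono:
  assumes "c ^ k \<in> jacobson_radical" and "k \<le> n"
  shows "c ^ n \<in> jacobson_radical"
  using jacobson_radical_mult_left[OF assms(1), of "c ^ (n - k)"] assms(2)
  by (simp flip: power_add)

lemma radical_nilpotent_add:
  fixes c d :: "'a::ring_1"
  assumes "radical_nilpotent c" and "radical_nilpotent d" and comm: "c * d = d * c"
  shows "radical_nilpotent (c + d)"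
proof -
  obtain k l where k: "c ^ k \<in> jacobson_radical" and l: "d ^ l \<in> jacobson_radical"
    using assms unfolding radical_nilpotent_def by auto
  \<comment> \<open>This generalisation replaces the binomial expansion: the induction distributes
    one factor \<open>c + d\<close> at a time, until \<open>k + l \<le> i + j\<close> forces
    \<open>k \<le> i\<close> or \<open>l \<le> j\<close>.\<close>
  have "c ^ i * d ^ j * (c + d) ^ m \<in> jacobson_radical" if "k + l \<le> i + j + m" for i j m
    using that
  proof (induction m arbitrary: i j)
    case 0
    then consider "k \<le> i" | "l \<le> j"
      by linarith
    then show ?case
    proof cases
      case 1
      have "c ^ i * d ^ j = d ^ j * c ^ i"
        using comm by (metis power_commuting_commutes)
      then show ?thesis
        using jacobson_radical_mult_left[OF jacobson_radical_power_mono[OF k 1]] by simp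
    next
      case 2
      then show ?thesis
        using jacobson_radical_mult_left[OF jacobson_radical_power_mono[OF l 2]] by simp
    qed
  next
    case (Suc m)
    have "d ^ j * c = c * d ^ j"
      using power_commuting_commutes[of d c j] comm by simp
    then have "c ^ i * d ^ j * (c + d) ^ Suc m
        = c ^ Suc i * d ^ j * (c + d) ^ m + c ^ i * d ^ Suc j * (c + d) ^ m"
      by (simp add: distrib_left distrib_right mult.assoc mult_left_commuting[of "d ^ j" c]
          power_Suc2[of c] power_Suc2[of d] power_Suc[of "c + d"] del: power_Suc)
    moreover have "c ^ Suc i * d ^ j * (c + d) ^ m \<in> jacobson_radical"
      using Suc.prems by (intro Suc.IH) simp
    moreover have "c ^ i * d ^ Suc j * (c + d) ^ m \<in> jacobson_radical"
      using Suc.prems by (intro Suc.IH) simp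
    ultimately show ?case
      by (simp add: jacobson_radical_add)
  qed
  from this[of 0 0 "k + l"] show ?thesis
    unfolding radical_nilpotent_def by auto
qed

lemma geometric_mult_commuting:
  fixes y :: "'a::ring_1"
  shows "(\<Sum>m<k. y ^ m) * (1 - y) = 1 - y ^ k" "(1 - y) * (\<Sum>m<k. y ^ m) = 1 - y ^ k"
proof (induction k)
  case (Suc k)
  case 1
  show ?case
    using Suc(1) by (simp add: distrib_right) (simp add: right_diff_distrib power_commutes)
  case 2
  show ?case
    using Suc(2) by (simp add: distrib_left) (simp add: left_diff_distrib power_commutes)
qed simp_all

text \<open>For every scalar multiple \<open>y\<close> of \<open>c\<close>, \<open>1 - y ^ k\<close>
  is invertible and is a multiple of \<open>1 - y\<close> on both sides. So \<open>1 - y\<close> has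
  a left and a right inverse, which agree, and \<open>quasinilpotentI\<close> applies.\<close>

lemma radical_nilpotent_imp_quasinilpotent:
  fixes c :: "'a::complex_banach_algebra_1"
  assumes "radical_nilpotent c"
  shows "quasinilpotent c"
proof (rule quasinilpotentI)
  fix t
  define y where "y = t *\<^sub>C c"
  obtain k where "c ^ k \<in> jacobson_radical"
    using assms unfolding radical_nilpotent_def by auto
  \<comment> \<open>A scalar acts as left multiplication by a multiple of \<open>1\<close>, so a
    left ideal absorbs it.\<close>
  from jacobson_radical_mult_left[OF this, of "t ^ k *\<^sub>C 1"]
  have "y ^ k \<in> jacobson_radical"
    by (simp add: y_def scaleC_power mult_scaleC_left)
  then obtain u where u: "u * (1 - y ^ k) = 1" "(1 - y ^ k) * u = 1"
    by (rule jacobson_radical_invertible)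
  let ?s = "\<Sum>m<k. y ^ m"
  have l: "u * ?s * (1 - y) = 1" and r: "(1 - y) * (?s * u) = 1"
    using u geometric_mult_commuting[where k = k and y = y]
    by (simp_all add: mult.assoc) (simp flip: mult.assoc)
  have "u * ?s = u * ?s * ((1 - y) * (?s * u))"
    using r by simp
  also have "\<dots> = ?s * u"
    using l by (simp flip: mult.assoc)
  finally show "\<exists>v. v * (1 - t *\<^sub>C c) = 1 \<and> (1 - t *\<^sub>C c) * v = 1"
    using l r unfolding y_def by metis
qed

section \<open>Pseudo Drazin inverses\<close>

lemma is_pdrazin_inverseD:
  fixes a x :: "'a::ring_1"
  assumes "is_pdrazin_inverse a x"
  shows "x * a = a * x" and "a * (x * x) = x" and "a * (x * (x * t)) = x * t"
proof -
  show 1: "x * a = a * x"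
    using assms by (simp add: is_pdrazin_inverse_def)
  have "x * a * x = x"
    using assms by (simp add: is_pdrazin_inverse_def)
  then show 2: "a * (x * x) = x"
    unfolding 1 mult.assoc .
  show "a * (x * (x * t)) = x * t"
    using arg_cong[OF 2, of "\<lambda>u. u * t"] by (simp add: mult.assoc)
qed

text \<open>The element \<open>p = 1 - a * x\<close> is idempotent and commutes with
  \<open>a\<close>, so for positive \<open>k\<close> the power \<open>(a * p) ^ k\<close> is
  \<open>a ^ k * p\<close>, the element in the definition.\<close>

lemma is_pdrazin_inverse_iff:
  fixes a x :: "'a::ring_1"
  shows "is_pdrazin_inverse a x
    \<longleftrightarrow> a * x = x * a \<and> x * a * x = x \<and> radical_nilpotent (a * (1 - a * x))"
proof (cases "a * x = x * a \<and> x * a * x = x")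
  case True
  then have xa: "x * a = a * x" and axx: "a * (x * x) = x"
    by (simp, metis mult.assoc)
  define p where "p = 1 - a * x"
  have "p * p = p" and "p * a = a * p"
    by (simp_all add: p_def algebra_simps mult.assoc xa axx mult_left_commuting[OF xa])
  then have "p ^ Suc k = p" for k
    by (induction k) simp_all
  then have "(a * p) ^ Suc k = a ^ Suc k * p" for k
    using power_mult_commuting[of a p "Suc k"] \<open>p * a = a * p\<close> by metis
  then have pow: "(a * p) ^ Suc k = a ^ Suc k - a ^ (Suc k + 1) * x" for k
    unfolding power_add[of a "Suc k" 1] power_one_right mult.assoc p_def by (simp add: right_diff_distrib)
  have "(\<exists>k\<ge>1. a ^ k - a ^ (k + 1) * x \<in> jacobson_radical) \<longleftrightarrow> radical_nilpotent (a * p)"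
    unfolding radical_nilpotent_def
  proof
    assume "\<exists>k\<ge>1. a ^ k - a ^ (k + 1) * x \<in> jacobson_radical"
    then obtain k where "1 \<le> k" and k: "a ^ k - a ^ (k + 1) * x \<in> jacobson_radical"
      by auto
    then obtain n where "k = Suc n"
      by (cases k) auto
    then have "(a * p) ^ k \<in> jacobson_radical"
      using k pow[of n] by simp
    then show "\<exists>k. (a * p) ^ k \<in> jacobson_radical"
      by (rule exI)
  next
    assume "\<exists>k. (a * p) ^ k \<in> jacobson_radical"
    then obtain k where "(a * p) ^ k \<in> jacobson_radical"
      by auto
    then have "(a * p) ^ Suc k \<in> jacobson_radical"
      by (rule jacobson_radical_power_mono) simp
    then have "a ^ Suc k - a ^ (Suc k + 1) * x \<in> jacobson_radical"
      unfolding pow .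
    then show "\<exists>k\<ge>1. a ^ k - a ^ (k + 1) * x \<in> jacobson_radical"
      by (intro exI[of _ "Suc k"]) simp
  qed
  then show ?thesis
    unfolding is_pdrazin_inverse_def p_def using True by simp
qed (auto simp: is_pdrazin_inverse_def)

text \<open>Iteration gives \<open>d = u ^ n * d * v ^ n\<close>, so \<open>norm d\<close> is
  bounded by a fixed multiple of \<open>norm u ^ n * norm (v ^ n)\<close>, which tends to 0.\<close>

lemma quasinilpotent_fixpoint_right:
  fixes d u v :: "'a::{real_normed_algebra,ring_1}"
  assumes "quasinilpotent v" and d: "d = u * d * v"
  shows "d = 0"
proof (rule quasinilpotent_eq_0I[OF assms(1)])
  have eq: "d = u ^ n * d * v ^ n" for n
  proof (induction n)
    case (Suc n)
    have "d = u ^ n * (u * d * v) * v ^ n"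
      using Suc d by simp
    then show ?case
      by (simp add: mult.assoc power_Suc2[of u] power_Suc[of v] del: power_Suc)
  qed simp
  fix n
  have "norm (u ^ n * d * v ^ n) \<le> norm (u ^ n) * norm d * norm (v ^ n)"
    by (intro order_trans[OF norm_mult_ineq] mult_right_mono norm_mult_ineq) simp
  also have "\<dots> \<le> norm (1::'a) * norm u ^ n * norm d * norm (v ^ n)"
    by (intro mult_right_mono norm_power_le) simp_all
  finally show "norm d \<le> norm (1::'a) * norm d * (norm u ^ n * norm (v ^ n))"
    using eq[of n] by (simp add: mult_ac)
qed simp

lemma quasinilpotent_fixpoint_left:
  fixes d u v :: "'a::{real_normed_algebra,ring_1}"
  assumes "quasinilpotent v" and d: "d = v * d * u"
  shows "d = 0"
proof (rule quasinilpotent_eq_0I[OF assms(1)])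
  have eq: "d = v ^ n * d * u ^ n" for n
  proof (induction n)
    case (Suc n)
    have "d = v ^ n * (v * d * u) * u ^ n"
      using Suc d by simp
    then show ?case
      by (simp add: mult.assoc power_Suc2[of v] power_Suc[of u] del: power_Suc)
  qed simp
  fix n
  have "norm (v ^ n * d * u ^ n) \<le> norm (v ^ n) * norm d * norm (u ^ n)"
    by (intro order_trans[OF norm_mult_ineq] mult_right_mono norm_mult_ineq) simp
  also have "\<dots> \<le> norm (v ^ n) * norm d * (norm (1::'a) * norm u ^ n)"
    by (intro mult_left_mono norm_power_le) simp
  finally show "norm d \<le> norm (1::'a) * norm d * (norm u ^ n * norm (v ^ n))"
    using eq[of n] by (simp add: mult_ac)
qed simp

section \<open>Double commutation and uniqueness\<close>

lemma is_pdrazin_inverse_quasinilpotent: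
  fixes a x :: "'a::complex_banach_algebra_1"
  assumes "is_pdrazin_inverse a x"
  shows "quasinilpotent (a * (1 - a * x))"
  using assms is_pdrazin_inverse_iff radical_nilpotent_imp_quasinilpotent by blast

lemma is_pdrazin_inverse_commutes:
  fixes a x c :: "'a::complex_banach_algebra_1"
  assumes "is_pdrazin_inverse a x" and ca: "c * a = a * c"
  shows "c * x = x * c"
proof -
  note qn = is_pdrazin_inverse_quasinilpotent[OF assms(1)]
  note ax = is_pdrazin_inverseD(1)[OF assms(1)] and xax = is_pdrazin_inverseD(2)[OF assms(1)]
    and r1 = is_pdrazin_inverseD(3)[OF assms(1)]
  note r = mult.assoc ca ax xax mult_left_commuting[OF ca] mult_left_commuting[OF ax]
  have "a * x * c * (1 - a * x) = 0"
    by (rule quasinilpotent_fixpoint_right[OF qn, of _ x])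
      (simp add: algebra_simps r r1)
  then have 1: "a * x * c = a * x * c * (a * x)"
    by (simp add: right_diff_distrib)
  have "(1 - a * x) * c * (a * x) = 0"
  proof (rule quasinilpotent_fixpoint_left[OF qn, of _ x])
    define p where "p = 1 - a * x"
    have "p * p = p" and ap: "a * p = p * a"
      by (simp_all add: p_def algebra_simps r r1)
    then have pp: "p * (p * t) = p * t" for t
      by (simp flip: mult.assoc)
    show "p * c * (a * x) = a * p * (p * c * (a * x)) * x"
      by (simp add: mult.assoc ap ca[symmetric] pp xax mult_left_commuting[OF ap]
          mult_left_commuting[OF ca[symmetric]])
  qed
  then have 2: "c * (a * x) = a * x * c * (a * x)"
    by (simp add: left_diff_distrib mult.assoc)
  \<comment> \<open>Both corners vanish, so \<open>c\<close> commutes with the idempotent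
    \<open>a * x\<close>. Inserting this idempotent lets \<open>a\<close> pass across
    \<open>c\<close> and turns \<open>x * c\<close> into \<open>c * x\<close>.\<close>
  have "x * c = x * (a * x * c)"
    by (simp add: r r1)
  also have "\<dots> = x * (c * (a * x))"
    using 1 2 by simp
  also have "\<dots> = (a * x * c) * x"
    by (simp add: r)
  also have "\<dots> = c * (a * x) * x"
    using 1 2 by simp
  also have "\<dots> = c * x"
    by (simp add: mult.assoc xax)
  finally show ?thesis ..
qed

text \<open>By double commutation \<open>x\<close> and \<open>y\<close> commute. The fixpoint lemma
  gives \<open>a * y = a * x * (a * y)\<close> and the symmetric identity, so the idempotents
  \<open>a * x\<close> and \<open>a * y\<close> coincide, which forces \<open>x = y\<close>.\<close>

lemma is_pdrazin_inverse_unique: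
  fixes a x y :: "'a::complex_banach_algebra_1"
  assumes x: "is_pdrazin_inverse a x" and y: "is_pdrazin_inverse a y"
  shows "x = y"
proof -
  note xa = is_pdrazin_inverseD(1)[OF x] and xx = is_pdrazin_inverseD(2,3)[OF x]
    and ya = is_pdrazin_inverseD(1)[OF y] and yy = is_pdrazin_inverseD(2,3)[OF y]
  have yx: "y * x = x * y"
    using is_pdrazin_inverse_commutes[OF x ya] .
  note r = mult.assoc ya xa yx xx yy
    mult_left_commuting[OF ya] mult_left_commuting[OF xa] mult_left_commuting[OF yx]
  have ayy: "a * (x * (y * y)) = x * y" "a * (x * (y * (y * t))) = x * (y * t)" for t
    using yy mult_left_commuting[OF xa] by metis+
  have "(1 - a * x) * (a * y) = 0"
    by (rule quasinilpotent_fixpoint_left[OF is_pdrazin_inverse_quasinilpotent[OF x], of _ y])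
      (simp add: algebra_simps r ayy)
  moreover have "(1 - a * y) * (a * x) = 0"
    by (rule quasinilpotent_fixpoint_left[OF is_pdrazin_inverse_quasinilpotent[OF y], of _ x])
      (simp add: algebra_simps r ayy)
  ultimately have eq: "a * y = a * x"
    by (simp add: algebra_simps r)
  have "x = x * (a * x)"
    by (simp add: r)
  also have "\<dots> = x * (a * y)"
    by (simp add: eq)
  also have "\<dots> = a * x * y"
    by (simp add: r)
  also have "\<dots> = a * y * y"
    by (simp add: eq)
  also have "\<dots> = y"
    by (simp add: r)
  finally show ?thesis .
qed

lemma pdrazin_inverse_eqI: "is_pdrazin_inverse a x \<Longrightarrow> a\<^sup>\<ddagger> = x"
  for a :: "'a::complex_banach_algebra_1"
  unfolding pdrazin_inverse_def by (rule the_equality) (auto intro: is_pdrazin_inverse_unique)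

lemma pdrazin_invertible_imp_is_pdrazin_inverse:
  "pdrazin_invertible a \<Longrightarrow> is_pdrazin_inverse a (a\<^sup>\<ddagger>)"
  for a :: "'a::complex_banach_algebra_1"
  unfolding pdrazin_invertible_def using pdrazin_inverse_eqI by metis

text \<open>Here \<open>g\<close> stands for \<open>a + b\<close>, so that \<open>g - a\<close> is
  \<open>b\<close>. On the corner of \<open>1 - a * x\<close> the element is the unit; on that of
  \<open>a * x\<close> it is \<open>x * g\<close>, where \<open>a\<^sup>2 * x\<close> inverts
  \<open>x\<close> and \<open>z\<close> is the p-Drazin inverse of \<open>g\<close>.\<close>

lemma is_pdrazin_inverse_one_plus:
  fixes a x g z :: "'a::ring_1"
  assumes x: "is_pdrazin_inverse a x" and z: "is_pdrazin_inverse g z"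
    and ga: "g * a = a * g" and gx: "g * x = x * g" and za: "z * a = a * z" and zx: "z * x = x * z"
  shows "is_pdrazin_inverse (1 + x * (g - a)) (1 - a * x + a\<^sup>2 * x * z)"
proof -
  note xa = is_pdrazin_inverseD(1)[OF x] and xx = is_pdrazin_inverseD(2,3)[OF x]
    and zg = is_pdrazin_inverseD(1)[OF z] and zz = is_pdrazin_inverseD(2,3)[OF z]
  note comm = mult.assoc ga gx za zx xa zg
    mult_left_commuting[OF ga] mult_left_commuting[OF gx] mult_left_commuting[OF za]
    mult_left_commuting[OF zx] mult_left_commuting[OF xa] mult_left_commuting[OF zg]
  note r = comm xx zz power2_eq_square
  let ?e = "1 + x * (g - a)" and ?w = "1 - a * x + a\<^sup>2 * x * z"
  have ew: "?e * ?w = 1 - a * x + a * x * (g * z)"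
    by (simp add: algebra_simps r)
  have "?w * ?e * ?w = ?w"
    unfolding mult.assoc[of ?w] ew by (simp add: algebra_simps r)
  moreover have "?e * ?w = ?w * ?e"
    by (simp add: algebra_simps r)
  \<comment> \<open>The defect is that of \<open>g\<close> times the commuting factor
    \<open>x\<close>, hence again nilpotent modulo the radical.\<close>
  moreover have "?e * (1 - ?e * ?w) = x * (g * (1 - g * z))"
    unfolding ew by (simp add: algebra_simps r)
  moreover have "radical_nilpotent (x * (g * (1 - g * z)))"
    by (rule radical_nilpotent_mult)
      (use z in \<open>simp_all add: is_pdrazin_inverse_iff algebra_simps comm\<close>)
  ultimately show ?thesis
    by (simp add: is_pdrazin_inverse_iff)
qed

text \<open>An algebraic form of the Neumann series: \<open>x * s = 0\<close> places
  \<open>s\<close> in the corner of \<open>p = 1 - a * x\<close>, and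
  \<open>s + y * a * s = p\<close> says that it inverts \<open>1 + y * a\<close> there.\<close>

lemma is_pdrazin_inverse_add:
  fixes a b x y w s :: "'a::ring_1"
  assumes x: "is_pdrazin_inverse a x" and y: "is_pdrazin_inverse b y"
    and w: "is_pdrazin_inverse (1 + x * b) w"
    and comm_ab: "b * a = a * b" "b * x = x * b" "y * a = a * y" "y * x = x * y"
    and comm_w: "w * a = a * w" "w * x = x * w" "w * b = b * w" "w * y = y * w"
    and comm_s: "s * a = a * s" "s * x = x * s" "b * s = s * b" "y * s = s * y" "w * s = s * w"
    and xs: "x * s = 0" and s: "s + y * a * s = 1 - a * x"
  shows "is_pdrazin_inverse (a + b) (w * x + y * s)"
proof -
  define e where "e = 1 + x * b"
  note w = w[folded e_def]
  note xa = is_pdrazin_inverseD(1)[OF x] and xx = is_pdrazin_inverseD(2,3)[OF x]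
    and yb = is_pdrazin_inverseD(1)[OF y] and yy = is_pdrazin_inverseD(2,3)[OF y]
    and we = is_pdrazin_inverseD(1)[OF w] and ww = is_pdrazin_inverseD(2,3)[OF w]
  note comm0 = mult.assoc xa yb comm_ab mult_left_commuting[OF xa] mult_left_commuting[OF yb]
    comm_ab[THEN mult_left_commuting]
  note comm1 = comm0 comm_w comm_s comm_w[THEN mult_left_commuting] comm_s[THEN mult_left_commuting]
  have comm_e: "e * a = a * e" "e * x = x * e" "e * b = b * e" "e * y = y * e" "e * s = s * e"
    by (simp_all add: e_def algebra_simps comm1)
  note comm = comm1 we mult_left_commuting[OF we] comm_e comm_e[THEN mult_left_commuting]
  have xs1: "x * (s * t) = 0" for t
    using xs by (simp flip: mult.assoc)
  note r = comm xx yy ww xs xs1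
  let ?G = "a + b" and ?z = "w * x + y * s" and ?p = "1 - a * x" and ?q = "1 - b * y"
  have Gx: "?G * x = a * x * e"
    unfolding e_def by (simp add: algebra_simps comm0 xx)
  have "?G * (y * s) = b * y * (s + y * a * s)"
    by (simp add: algebra_simps r)
  then have Gz: "?G * ?z = a * x * e * w + b * y * ?p"
    using Gx unfolding s by (simp add: distrib_left comm_w flip: mult.assoc)
  have "?G * ?z = ?z * ?G"
    by (simp add: algebra_simps r)
  moreover have "?z * ?G * ?z = ?z"
    unfolding mult.assoc[of ?z] Gz by (simp add: algebra_simps r)
  moreover have "radical_nilpotent (?G * (1 - ?G * ?z))"
  proof -
    \<comment> \<open>The idempotents split the defect into three commuting pieces: the defects of
      \<open>1 + x * b\<close>, \<open>a\<close> and \<open>b\<close>, each times a commuting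
      factor.\<close>
    have "?G * (1 - ?G * ?z) = a * (?G * x) * (1 - e * w) + ?G * ?p * ?q"
      unfolding Gz by (simp add: algebra_simps r)
    also have "\<dots> = a * a * x * (e * (1 - e * w)) + ?q * (a * ?p) + ?p * (b * ?q)"
      unfolding Gx by (simp add: algebra_simps r)
    finally have eq: "?G * (1 - ?G * ?z)
      = a * a * x * (e * (1 - e * w)) + ?q * (a * ?p) + ?p * (b * ?q)" .
    have "radical_nilpotent (a * a * x * (e * (1 - e * w)))"
      by (rule radical_nilpotent_mult)
        (use w in \<open>simp_all add: is_pdrazin_inverse_iff algebra_simps comm\<close>)
    moreover have "radical_nilpotent (?q * (a * ?p))"
      by (rule radical_nilpotent_mult)
        (use x in \<open>simp_all add: is_pdrazin_inverse_iff algebra_simps comm\<close>)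
    moreover have "radical_nilpotent (?p * (b * ?q))"
      by (rule radical_nilpotent_mult)
        (use y in \<open>simp_all add: is_pdrazin_inverse_iff algebra_simps comm\<close>)
    ultimately show ?thesis
      unfolding eq by (intro radical_nilpotent_add) (simp_all add: algebra_simps comm)
  qed
  ultimately show ?thesis
    by (simp add: is_pdrazin_inverse_iff)
qed

section \<open>The Neumann series and the formula for \<open>a + b\<close>\<close>

lemma suminf_power_mult:
  fixes t p :: "'a::{real_normed_algebra,ring_1,banach}"
  assumes "summable (\<lambda>i. t ^ i * p)"
  shows "(\<Sum>i. t ^ i * p) = p + t * (\<Sum>i. t ^ i * p)"
  using suminf_split_head[OF assms] suminf_mult[OF assms, of t] by (simp add: mult.assoc)

lemma suminf_power_mult_commute:
  fixes c t p :: "'a::{real_normed_algebra,ring_1,banach}"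
  assumes "summable (\<lambda>i. t ^ i * p)" and "c * t = t * c" and "c * p = p * c"
  shows "(\<Sum>i. t ^ i * p) * c = c * (\<Sum>i. t ^ i * p)"
proof -
  have "c * (t ^ i * p) = t ^ i * p * c" for i
    using power_commuting_commutes[of t c i] assms(2,3) by (metis mult.assoc)
  then show ?thesis
    using suminf_mult[OF assms(1), of c] suminf_mult2[OF assms(1), of c] by simp
qed

theorem theorem2p7:
  fixes a b :: "'a::complex_banach_algebra_1"
  assumes "pdrazin_invertible a" and "pdrazin_invertible b" and "a * b = b * a"
  shows "(pdrazin_invertible (a + b) \<longleftrightarrow> pdrazin_invertible (1 + a\<^sup>\<ddagger> * b)) \<and>
    (pdrazin_invertible (a + b) \<longrightarrow>
      summable (\<lambda>i::nat. (- b\<^sup>\<ddagger> * a * a\<^sup>\<Pi>) ^ i * a\<^sup>\<Pi>) \<and>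
      (a + b)\<^sup>\<ddagger> = (1 + a\<^sup>\<ddagger> * b)\<^sup>\<ddagger> * a\<^sup>\<ddagger>
        + b\<^sup>\<ddagger> * (\<Sum>i::nat. (- b\<^sup>\<ddagger> * a * a\<^sup>\<Pi>) ^ i * a\<^sup>\<Pi>) \<and>
      (1 + a\<^sup>\<ddagger> * b)\<^sup>\<ddagger> = a\<^sup>\<Pi> + a\<^sup>2 * a\<^sup>\<ddagger> * (a + b)\<^sup>\<ddagger>)"
proof -
  define x y p t s where "x = a\<^sup>\<ddagger>" and "y = b\<^sup>\<ddagger>" and "p = 1 - a * x"
    and "t = - y * a * p" and "s = (\<Sum>i. t ^ i * p)"
  have x: "is_pdrazin_inverse a x" and y: "is_pdrazin_inverse b y"
    unfolding x_def y_def using assms pdrazin_invertible_imp_is_pdrazin_inverse by blast+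
  have ba: "b * a = a * b"
    using assms(3) by simp
  have bx: "b * x = x * b"
    using is_pdrazin_inverse_commutes[OF x ba] .
  have ya: "y * a = a * y"
    using is_pdrazin_inverse_commutes[OF y assms(3)] by simp
  have yx: "y * x = x * y"
    using is_pdrazin_inverse_commutes[OF y bx[symmetric]] by simp
  note xa = is_pdrazin_inverseD(1)[OF x] and xx = is_pdrazin_inverseD(2,3)[OF x]
    and yb = is_pdrazin_inverseD(1)[OF y]
  note comm = mult.assoc ba bx ya yx xa yb
    mult_left_commuting[OF ba] mult_left_commuting[OF bx] mult_left_commuting[OF ya]
    mult_left_commuting[OF yx] mult_left_commuting[OF xa] mult_left_commuting[OF yb]
  \<comment> \<open>\<open>t\<close> is \<open>a * p\<close>, nilpotent modulo the radical, times
    the commuting factor \<open>- y\<close>; hence it is quasinilpotent and the series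
    converges.\<close>
  have "radical_nilpotent (- y * (a * p))"
    by (rule radical_nilpotent_mult)
      (use x in \<open>simp_all add: is_pdrazin_inverse_iff p_def algebra_simps comm\<close>)
  then have sum: "summable (\<lambda>i. t ^ i * p)"
    unfolding t_def mult.assoc
    by (intro quasinilpotent_summable radical_nilpotent_imp_quasinilpotent)
  have s_comm: "s * c = c * s" if "c * a = a * c" "c * x = x * c" "c * y = y * c" for c
    unfolding s_def
    by (rule suminf_power_mult_commute[OF sum])
      (simp_all add: t_def p_def algebra_simps that mult_left_commuting[OF that(1)]
        mult_left_commuting[OF that(2)] mult_left_commuting[OF that(3)])
  have sa: "s * a = a * s" and sx: "s * x = x * s" and sb: "s * b = b * s" and sy: "s * y = y * s"
    by (rule s_comm; simp add: comm)+
  \<comment> \<open>This recursion and \<open>x * s = 0\<close> yield the corner equation that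
    \<open>is_pdrazin_inverse_add\<close> requires of \<open>s\<close>.\<close>
  have s_eq: "s = p + t * s"
    unfolding s_def by (rule suminf_power_mult[OF sum])
  have "x * p = 0" and "x * t = 0"
    by (simp_all add: p_def t_def algebra_simps comm xx)
  then have xs: "x * s = 0"
    by (subst s_eq) (simp add: distrib_left flip: mult.assoc)
  have "p * s = s"
    by (simp add: p_def left_diff_distrib mult.assoc xs)
  then have "t * s = - (y * a * s)"
    by (simp add: t_def mult.assoc)
  moreover have "s - t * s = p"
    using s_eq by (metis add_diff_cancel_right')
  ultimately have s: "s + y * a * s = 1 - a * x"
    by (simp add: p_def)
  have one_plus: "is_pdrazin_inverse (1 + x * b) (p + a\<^sup>2 * x * z)"
    if z: "is_pdrazin_inverse (a + b) z" for z
  proof -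
    have "z * a = a * z" "z * x = x * z"
      using is_pdrazin_inverse_commutes[OF z, of a] is_pdrazin_inverse_commutes[OF z, of x]
      by (simp_all add: algebra_simps comm)
    then show ?thesis
      using is_pdrazin_inverse_one_plus[OF x z] unfolding p_def
      by (simp add: distrib_left distrib_right comm)
  qed
  have add: "is_pdrazin_inverse (a + b) (w * x + y * s)"
    if w: "is_pdrazin_inverse (1 + x * b) w" for w
  proof -
    \<comment> \<open>Whatever commutes with \<open>x\<close> and \<open>b\<close> commutes with
      \<open>1 + x * b\<close>, hence with \<open>w\<close>.\<close>
    have wc: "w * c = c * w" if "c * x = x * c" "c * b = b * c" for c
      using is_pdrazin_inverse_commutes[OF w, of c] that
      by (simp add: distrib_left distrib_right mult.assoc mult_left_commuting[OF that(1)])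
    have "w * a = a * w" "w * x = x * w" "w * b = b * w" "w * y = y * w" "w * s = s * w"
      by (rule wc; simp add: comm sx sb)+
    then show ?thesis
      by (intro is_pdrazin_inverse_add[OF x y w ba bx ya yx _ _ _ _ sa sx sb[symmetric]
            sy[symmetric] _ xs s])
  qed
  have "(1 + x * b)\<^sup>\<ddagger> = p + a\<^sup>2 * x * (a + b)\<^sup>\<ddagger> \<and> (a + b)\<^sup>\<ddagger> = (1 + x * b)\<^sup>\<ddagger> * x + y * s"
    if "pdrazin_invertible (a + b)"
  proof -
    \<comment> \<open>\<open>one_plus\<close> at \<open>(a + b)\<^sup>\<ddagger>\<close> produces an
      inverse of \<open>1 + x * b\<close>; \<open>add\<close> turns it back into one of
      \<open>a + b\<close>, and uniqueness on both sides gives both formulas.\<close>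
    have w: "is_pdrazin_inverse (1 + x * b) (p + a\<^sup>2 * x * (a + b)\<^sup>\<ddagger>)"
      using one_plus[OF pdrazin_invertible_imp_is_pdrazin_inverse[OF that]] .
    from pdrazin_inverse_eqI[OF w] pdrazin_inverse_eqI[OF add[OF w]] show ?thesis
      by simp
  qed
  moreover have "pdrazin_invertible (a + b) \<longleftrightarrow> pdrazin_invertible (1 + x * b)"
    unfolding pdrazin_invertible_def
    by (intro iffI; elim exE; rule exI; erule add one_plus)
  ultimately show ?thesis
    using sum unfolding s_def t_def p_def x_def y_def pdrazin_idempotent_def by blast
qed

end
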